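(* Let $X,Y\subseteq\mathbb{P}^2$ be two sets of points with $|X|,|Y|\geq 3$, $|X\cup Y|\geq 4$ and $X\cup Y\subseteq L$, where $L$ is a line. Then the points of $X\star Y$ are not collinear if and only if $L\cap\Delta_0=\emptyset$.
   Context: Work over an algebraically closed field $\mathbb{K}$; $\mathbb{P}^2$ is the projective plane. For points $P=[p_0:p_1:p_2]$, $Q=[q_0:q_1:q_2]$, the Hadamard product is $P\star Q=[p_0q_0:p_1q_1:p_2q_2]$, defined when not all $p_iq_i$ vanish. For subsets $X,Y\subseteq\mathbb{P}^2$, $X\star Y$ is the Zariski closure of the set of all defined products $P\star Q$ with $P\in X$, $Q\in Y$ (for finite sets, just the set of defined products). $\Delta_0$ is the set of coordinate points $[1:0:0],[0:1:0],[0:0:1]$. *)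

theory Defs
  imports
    "HOL-Analysis.Cartesian_Space"
    "HOL-Computational_Algebra.Polynomial"
begin

text \<open>
  The projective plane over a field: nonzero vectors modulo nonzero scalars. The homogeneous
  coordinates are indexed by the three-element type \<open>3\<close>.
\<close>

definition proj_rel :: "'a::field ^ 3 \<Rightarrow> 'a ^ 3 \<Rightarrow> bool" where
  "proj_rel v w \<longleftrightarrow> v \<noteq> 0 \<and> w \<noteq> 0 \<and> (\<exists>c. c \<noteq> 0 \<and> w = c *s v)"

lemma part_equivp_proj_rel: "part_equivp (proj_rel :: 'a::field ^ 3 \<Rightarrow> 'a ^ 3 \<Rightarrow> bool)"
proof (rule part_equivpI)
  have "proj_rel (1 :: 'a ^ 3) 1"
    unfolding proj_rel_def by (auto intro!: exI[of _ 1])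
  then show "\<exists>x. proj_rel (x :: 'a ^ 3) x" ..
  show "symp (proj_rel :: 'a ^ 3 \<Rightarrow> _)"
  proof (rule sympI)
    fix v w :: "'a ^ 3"
    assume "proj_rel v w"
    then obtain c where c: "v \<noteq> 0" "w \<noteq> 0" "c \<noteq> 0" "w = c *s v"
      unfolding proj_rel_def by blast
    then have "inverse c \<noteq> 0" "v = inverse c *s w"
      by (auto simp: vector_smult_assoc)
    with c(1,2) show "proj_rel w v"
      unfolding proj_rel_def by blast
  qed
  show "transp (proj_rel :: 'a ^ 3 \<Rightarrow> _)"
  proof (rule transpI)
    fix u v w :: "'a ^ 3"
    assume "proj_rel u v" "proj_rel v w"
    then obtain c d where c: "u \<noteq> 0" "w \<noteq> 0" "c \<noteq> 0" "d \<noteq> 0" "v = c *s u" "w = d *s v"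
      unfolding proj_rel_def by blast
    then have "d * c \<noteq> 0" "w = (d * c) *s u"
      by (auto simp: vector_smult_assoc)
    with c(1,2) show "proj_rel u w"
      unfolding proj_rel_def by blast
  qed
qed

text \<open>\<open>Pt v\<close> is the point with homogeneous coordinates \<open>v\<close>; it is meaningful only for \<open>v \<noteq> 0\<close>.\<close>

quotient_type (overloaded) 'a proj2 = "'a::field ^ 3" / partial: proj_rel
  morphisms rep_proj2 Pt
  by (rule part_equivp_proj_rel)

lemma Pt_eq_iff:
  assumes "v \<noteq> 0" "w \<noteq> 0"
  shows "Pt v = Pt w \<longleftrightarrow> (\<exists>c. c \<noteq> 0 \<and> w = c *s v)"
proof -
  have refl: "proj_rel v v" if "v \<noteq> 0" for v :: "'a ^ 3"
    using that unfolding proj_rel_def by (auto intro!: exI[of _ 1])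
  have "Pt v = Pt w \<longleftrightarrow> proj_rel v w"
    using Quotient_rel[OF Quotient_proj2, of v w] refl[OF assms(1)] refl[OF assms(2)] by blast
  with assms show ?thesis
    by (simp add: proj_rel_def)
qed

lift_definition on_line :: "'a::field ^ 3 \<Rightarrow> 'a proj2 \<Rightarrow> bool" is
  "\<lambda>a v. (\<Sum>i\<in>UNIV. a $ i * v $ i) = 0"
proof -
  fix a v w :: "'a ^ 3"
  assume "proj_rel v w"
  then obtain c where c: "c \<noteq> 0" "w = c *s v"
    unfolding proj_rel_def by blast
  have "(\<Sum>i\<in>UNIV. a $ i * w $ i) = c * (\<Sum>i\<in>UNIV. a $ i * v $ i)"
    by (simp add: c(2) sum_distrib_left algebra_simps)
  with c(1) show "((\<Sum>i\<in>UNIV. a $ i * v $ i) = 0) = ((\<Sum>i\<in>UNIV. a $ i * w $ i) = 0)"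
    by simp
qed

definition proj_line :: "'a::field proj2 set \<Rightarrow> bool" where
  "proj_line L \<longleftrightarrow> (\<exists>a. a \<noteq> 0 \<and> L = {P. on_line a P})"

definition collinear_points :: "'a::field proj2 set \<Rightarrow> bool" where
  "collinear_points S \<longleftrightarrow> (\<exists>L. proj_line L \<and> S \<subseteq> L)"

definition coord_points :: "'a::field proj2 set"  (\<open>\<Delta>\<^sub>0\<close>) where
  "\<Delta>\<^sub>0 = {Pt (axis k 1) | k. True}"

text \<open>
  The value at \<open>v\<close> of the form of degree \<open>d\<close> in three variables in which the monomial with
  exponents \<open>e\<close> has coefficient \<open>c e\<close>; the coefficients at \<open>e\<close> of total degree other than \<open>d\<close>
  play no role.
\<close>

definition form_eval :: "nat \<Rightarrow> ((3 \<Rightarrow> nat) \<Rightarrow> 'a) \<Rightarrow> 'a::field ^ 3 \<Rightarrow> 'a" where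
  "form_eval d c v = (\<Sum>e | (\<Sum>i\<in>UNIV. e i) = d. c e * (\<Prod>i\<in>UNIV. (v $ i) ^ e i))"

lemma finite_exponents: "finite {e :: 3 \<Rightarrow> nat. (\<Sum>i\<in>UNIV. e i) = d}"
proof (rule finite_subset)
  show "{e :: 3 \<Rightarrow> nat. (\<Sum>i\<in>UNIV. e i) = d} \<subseteq> Pi\<^sub>E UNIV (\<lambda>_. {..d})"
    by (auto simp: PiE_def intro: member_le_sum)
qed (auto intro: finite_PiE)

lemma form_eval_scale: "form_eval d c (r *s v) = r ^ d * form_eval d c v"
proof -
  have "(\<Prod>i\<in>UNIV. ((r *s v) $ i) ^ e i) = r ^ d * (\<Prod>i\<in>UNIV. (v $ i) ^ e i)"
    if "(\<Sum>i\<in>UNIV. e i) = d" for e :: "3 \<Rightarrow> nat"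
    by (simp add: power_mult_distrib prod.distrib power_sum flip: that)
  then show ?thesis
    unfolding form_eval_def by (auto simp: sum_distrib_left intro!: sum.cong)
qed

lift_definition form_vanishes :: "nat \<Rightarrow> ((3 \<Rightarrow> nat) \<Rightarrow> 'a) \<Rightarrow> 'a::field proj2 \<Rightarrow> bool" is
  "\<lambda>d c v. form_eval d c v = 0"
  by (auto simp: proj_rel_def form_eval_scale)

definition zariski_closed :: "'a::field proj2 set \<Rightarrow> bool" where
  "zariski_closed Z \<longleftrightarrow> (\<exists>F. Z = {P. \<forall>(d, c)\<in>F. form_vanishes d c P})"

definition zariski_closure :: "'a::field proj2 set \<Rightarrow> 'a proj2 set" where
  "zariski_closure S = \<Inter>{Z. zariski_closed Z \<and> S \<subseteq> Z}"

text \<open>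
  The product \<open>v * w\<close> of vectors is componentwise, so \<open>v * w \<noteq> 0\<close> says that the product of the
  two points is defined. Ranging over all representatives is harmless: rescaling \<open>v\<close> or \<open>w\<close>
  rescales \<open>v * w\<close>.
\<close>

definition hadamard_products :: "'a::field proj2 set \<Rightarrow> 'a proj2 set \<Rightarrow> 'a proj2 set" where
  "hadamard_products X Y =
    {Pt (v * w) | v w. v \<noteq> 0 \<and> w \<noteq> 0 \<and> Pt v \<in> X \<and> Pt w \<in> Y \<and> v * w \<noteq> 0}"

definition hadamard :: "'a::field proj2 set \<Rightarrow> 'a proj2 set \<Rightarrow> 'a proj2 set"  (infixl \<open>\<star>\<close> 70) where
  "X \<star> Y = zariski_closure (hadamard_products X Y)"

end

theory Submission
  imports Defs
begin

text \<open>
  Let \<open>L\<close> be the line \<open>a \<bullet> v = 0\<close>. It contains the \<open>k\<close>-th coordinate point exactly when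
  \<open>a\<^sub>k = 0\<close>. A line is Zariski closed, so \<open>X \<star> Y\<close> is collinear exactly when some linear form
  \<open>b \<noteq> 0\<close> kills all products \<open>v * w\<close> of representatives; undefined products, \<open>v * w = 0\<close>, are
  killed anyway. The question is thus whether the bilinear form \<open>b \<bullet> (v * w)\<close> can vanish on
  \<open>X \<times> Y\<close> for some \<open>b \<noteq> 0\<close>.

  If no \<open>a\<^sub>k\<close> is zero, it cannot. Two distinct points of \<open>X\<close> span the plane \<open>a\<^sup>\<bottom>\<close>
  (\<open>line_spanned_by_two_points\<close>), and so do two of \<open>Y\<close>; by bilinearity the form then vanishes on
  all of \<open>a\<^sup>\<bottom> \<times> a\<^sup>\<bottom>\<close>. But the products of vectors of \<open>a\<^sup>\<bottom>\<close> span the whole space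
  (\<open>products_of_line_span\<close>), since they include nonzero multiples of the unit vectors, whence
  \<open>b = 0\<close>.

  If \<open>a\<^sub>k = 0\<close>, with \<open>i\<close> and \<open>j\<close> the other two indices, the equation of \<open>L\<close> is
  \<open>a\<^sub>i v\<^sub>i = - a\<^sub>j v\<^sub>j\<close>. Multiplying the equations of \<open>v\<close> and \<open>w\<close> gives
  \<open>a\<^sub>i\<^sup>2 v\<^sub>i w\<^sub>i = a\<^sub>j\<^sup>2 v\<^sub>j w\<^sub>j\<close>, which is a line through all the products
  (\<open>hadamard_collinear\<close>).
\<close>

section \<open>Lines and their equations\<close>

abbreviation pairing :: "'a::field ^ 3 \<Rightarrow> 'a ^ 3 \<Rightarrow> 'a" where
  "pairing a v \<equiv> \<Sum>i\<in>UNIV. a $ i * v $ i"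

lemma proj_rel_refl: "v \<noteq> 0 \<Longrightarrow> proj_rel v v"
  unfolding proj_rel_def by (auto intro!: exI[of _ 1])

lemma on_line_Pt: "v \<noteq> 0 \<Longrightarrow> on_line a (Pt v) \<longleftrightarrow> pairing a v = 0"
  by (simp add: on_line.abs_eq proj_rel_refl)

lemma form_vanishes_Pt: "v \<noteq> 0 \<Longrightarrow> form_vanishes d c (Pt v) \<longleftrightarrow> form_eval d c v = 0"
  by (simp add: form_vanishes.abs_eq proj_rel_refl)

lemma proj2_cases:
  obtains v where "v \<noteq> 0" "P = Pt v"
proof -
  have "\<exists>v. v \<noteq> 0 \<and> P = Pt v"
    by (induction P rule: proj2.abs_induct) (auto simp: proj_rel_def)
  with that show thesis by blast
qed

lemma exponents_of_degree_1:
  "{e :: 3 \<Rightarrow> nat. (\<Sum>i\<in>UNIV. e i) = 1} = range (\<lambda>k i. if i = k then 1 else 0)"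
proof -
  have "e \<in> range (\<lambda>k i. if i = k then 1 else 0)" if e: "(\<Sum>i\<in>UNIV. e i) = 1" for e :: "3 \<Rightarrow> nat"
  proof -
    obtain k where "e k = 1" "\<forall>i\<in>UNIV. k \<noteq> i \<longrightarrow> e i = 0"
      using e sum_eq_1_iff[of "UNIV :: 3 set" e] by auto
    then have "e = (\<lambda>i. if i = k then 1 else 0)"
      by (auto simp: fun_eq_iff)
    then show ?thesis by blast
  qed
  then show ?thesis by auto
qed

text \<open>
  The coefficient function is arranged to equal \<open>b\<^sub>k\<close> at the exponent vector of the \<open>k\<close>-th
  variable, so this realises an arbitrary linear form as a form of degree 1.
\<close>

lemma form_eval_linear:
  "form_eval 1 (\<lambda>e. \<Sum>i\<in>UNIV. of_nat (e i) * b $ i) v = pairing b v"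
proof -
  let ?u = "\<lambda>(k::3) i::3. if i = k then 1 else (0::nat)"
  have inj: "inj ?u"
    by (rule injI) (metis zero_neq_one)
  have *: "of_nat (if P then 1 else 0) * x = (if P then x else 0)"
    "y ^ (if P then 1 else 0) = (if P then y else 1)" for P and x y :: 'a
    by auto
  show ?thesis
    unfolding form_eval_def exponents_of_degree_1 sum.reindex[OF inj] o_def *
    by simp
qed

lemma zariski_closed_line: "zariski_closed {P. on_line b P}"
proof -
  have "on_line b P \<longleftrightarrow> form_vanishes 1 (\<lambda>e. \<Sum>i\<in>UNIV. of_nat (e i) * b $ i) P" for P
    by (cases P rule: proj2_cases) (simp add: on_line_Pt form_vanishes_Pt form_eval_linear del: One_nat_def)
  then have "{P. on_line b P} =
      {P. \<forall>(d, c)\<in>{(1, \<lambda>e. \<Sum>i\<in>UNIV. of_nat (e i) * b $ i)}. form_vanishes d c P}"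
    by simp
  then show ?thesis unfolding zariski_closed_def by blast
qed

section \<open>Collinearity of a Hadamard product\<close>

text \<open>
  Here the quotient, the closure and the condition that the product be defined all disappear:
  lines are closed, so they contain the closure as soon as they contain the products, and a vector
  \<open>v * w = 0\<close> satisfies every linear equation.
\<close>

lemma collinear_hadamard_iff:
  "collinear_points (X \<star> Y) \<longleftrightarrow>
    (\<exists>b. b \<noteq> 0 \<and> (\<forall>v w. v \<noteq> 0 \<longrightarrow> w \<noteq> 0 \<longrightarrow> Pt v \<in> X \<longrightarrow> Pt w \<in> Y \<longrightarrow> pairing b (v * w) = 0))"
  (is "?l \<longleftrightarrow> ?r")
proof -
  have closure: "X \<star> Y \<subseteq> {P. on_line b P} \<longleftrightarrow> hadamard_products X Y \<subseteq> {P. on_line b P}" for b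
    unfolding hadamard_def zariski_closure_def using zariski_closed_line[of b] by blast
  have "hadamard_products X Y \<subseteq> {P. on_line b P} \<longleftrightarrow>
      (\<forall>v w. v \<noteq> 0 \<longrightarrow> w \<noteq> 0 \<longrightarrow> Pt v \<in> X \<longrightarrow> Pt w \<in> Y \<longrightarrow> pairing b (v * w) = 0)" for b
  proof -
    have "hadamard_products X Y \<subseteq> {P. on_line b P} \<longleftrightarrow>
      (\<forall>v w. v \<noteq> 0 \<longrightarrow> w \<noteq> 0 \<longrightarrow> Pt v \<in> X \<longrightarrow> Pt w \<in> Y \<longrightarrow> v * w \<noteq> 0 \<longrightarrow> on_line b (Pt (v * w)))"
      unfolding hadamard_products_def by blast
    also have "\<dots> \<longleftrightarrow> (\<forall>v w. v \<noteq> 0 \<longrightarrow> w \<noteq> 0 \<longrightarrow> Pt v \<in> X \<longrightarrow> Pt w \<in> Y \<longrightarrow> pairing b (v * w) = 0)"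
    proof -
      have "(v * w \<noteq> 0 \<longrightarrow> on_line b (Pt (v * w))) \<longleftrightarrow> pairing b (v * w) = 0" for v w
        by (cases "v * w = 0") (auto simp: on_line_Pt)
      then show ?thesis by simp
    qed
    finally show ?thesis .
  qed
  moreover have "collinear_points (X \<star> Y) \<longleftrightarrow> (\<exists>b. b \<noteq> 0 \<and> X \<star> Y \<subseteq> {P. on_line b P})"
    unfolding collinear_points_def proj_line_def by blast
  ultimately show ?thesis
    by (simp only: closure)
qed

lemma pairing_axis: "pairing a (axis k 1) = a $ k"
  by (simp add: axis_def if_distrib cong: if_cong)

lemma line_meets_coord_points_iff:
  assumes "L = {P. on_line a P}"
  shows "L \<inter> \<Delta>\<^sub>0 = {} \<longleftrightarrow> (\<forall>k. a $ k \<noteq> 0)"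
proof -
  have "on_line a (Pt (axis k 1)) \<longleftrightarrow> a $ k = 0" for k
    by (simp add: on_line_Pt pairing_axis axis_eq_0_iff)
  then show ?thesis
    unfolding assms coord_points_def by auto
qed

section \<open>Lines that avoid the coordinate points\<close>

text \<open>
  As \<open>a\<^sub>3 \<noteq> 0\<close>, a vector on the line is determined by its first two coordinates; in these the
  coefficients are given by Cramer's rule. The determinant vanishes only if \<open>v1\<close> and \<open>v2\<close> are
  proportional, that is, represent the same point.
\<close>

lemma line_spanned_by_two_points:
  fixes a v1 v2 u :: "'a::field ^ 3"
  assumes a: "a $ 3 \<noteq> 0"
    and "pairing a v1 = 0" "pairing a v2 = 0" "pairing a u = 0"
    and v: "v1 \<noteq> 0" "v2 \<noteq> 0" "Pt v1 \<noteq> Pt v2"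
  obtains r s where "u = r *s v1 + s *s v2"
proof -
  have eqs: "a$1 * v1$1 + a$2 * v1$2 + a$3 * v1$3 = 0" "a$1 * v2$1 + a$2 * v2$2 + a$3 * v2$3 = 0"
    "a$1 * u$1 + a$2 * u$2 + a$3 * u$3 = 0"
    using assms(2-4) by (simp_all add: sum_3)
  have ext: "x = y" if "x $ 1 = y $ 1" "x $ 2 = y $ 2"
    "a$1 * x$1 + a$2 * x$2 + a$3 * x$3 = 0" "a$1 * y$1 + a$2 * y$2 + a$3 * y$3 = 0" for x y :: "'a ^ 3"
  proof -
    have "a $ 3 * x $ 3 = a $ 3 * y $ 3"
      using that by (metis add_left_cancel)
    with a that(1,2) show ?thesis by (simp add: vec_eq_iff forall_3)
  qed
  let ?D = "v1 $ 1 * v2 $ 2 - v1 $ 2 * v2 $ 1"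
  have comb: "a$1 * x$1 + a$2 * x$2 + a$3 * x$3 = 0" if "x = r *s v1 + s *s v2" for x r s
  proof -
    have "a$1 * x$1 + a$2 * x$2 + a$3 * x$3 = r * (a$1 * v1$1 + a$2 * v1$2 + a$3 * v1$3)
        + s * (a$1 * v2$1 + a$2 * v2$2 + a$3 * v2$3)"
      unfolding that by (simp add: algebra_simps)
    then show ?thesis using eqs by simp
  qed
  have D: "?D \<noteq> 0"
  proof
    assume D: "?D = 0"
    have zero: "x = 0" if "x $ 1 = 0" "x $ 2 = 0" "a$1 * x$1 + a$2 * x$2 + a$3 * x$3 = 0" for x :: "'a ^ 3"
      using ext[of x 0] that by simp
    obtain k where k: "k = 1 \<or> k = 2" "v1 $ k \<noteq> 0"
      using zero[of v1] eqs v(1) by blast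
    have "v1 $ k *s v2 = v2 $ k *s v1"
    proof (rule ext)
      show "(v1 $ k *s v2) $ 1 = (v2 $ k *s v1) $ 1" "(v1 $ k *s v2) $ 2 = (v2 $ k *s v1) $ 2"
        using k(1) D by (auto simp: mult.commute)
    qed (rule comb[of _ 0 "v1 $ k"] comb[of _ "v2 $ k" 0]; simp)+
    then have eq: "v2 = (v2 $ k / v1 $ k) *s v1"
      using k by (simp add: vec_eq_iff field_simps)
    moreover have "v2 $ k / v1 $ k \<noteq> 0" using eq v(2) by auto
    ultimately show False using v Pt_eq_iff by blast
  qed
  show thesis
  proof
    let ?r = "(u $ 1 * v2 $ 2 - u $ 2 * v2 $ 1) / ?D" and ?s = "(v1 $ 1 * u $ 2 - v1 $ 2 * u $ 1) / ?D"
    show "u = ?r *s v1 + ?s *s v2"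
    proof (rule ext[OF _ _ eqs(3) comb[OF refl]])
      show "u $ 1 = (?r *s v1 + ?s *s v2) $ 1" "u $ 2 = (?r *s v1 + ?s *s v2) $ 2"
        using D by (simp_all add: divide_simps) (simp_all add: algebra_simps)
    qed
  qed
qed

lemma pairing_combination:
  "pairing b ((r *s v1 + s *s v2) * w) = r * pairing b (v1 * w) + s * pairing b (v2 * w)"
  "pairing b (w * (r *s v1 + s *s v2)) = r * pairing b (w * v1) + s * pairing b (w * v2)"
  by (simp_all add: algebra_simps sum.distrib sum_distrib_left)

text \<open>
  For \<open>{i, j, k} = {1, 2, 3}\<close>, the vector of \<open>a\<^sup>\<bottom>\<close> supported on \<open>{i, k}\<close> and the one supported
  on \<open>{j, k}\<close> have a product supported on \<open>k\<close> alone, which forces \<open>b\<^sub>k = 0\<close>.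
\<close>

lemma products_of_line_span:
  fixes a b :: "'a::field ^ 3"
  assumes a: "\<And>k. a $ k \<noteq> 0"
    and b: "\<And>v w. pairing a v = 0 \<Longrightarrow> pairing a w = 0 \<Longrightarrow> pairing b (v * w) = 0"
  shows "b = 0"
proof -
  have sep: "b $ k * (a $ i * a $ j) = 0" if "i \<noteq> k" "j \<noteq> k" "i \<noteq> j" for i j k
  proof -
    define e where "e i = a $ i *s axis k 1 - a $ k *s axis i 1" for i
    have "pairing a (e i) = 0" for i
    proof -
      have "pairing a (e i) = a $ i * pairing a (axis k 1) - a $ k * pairing a (axis i 1)"
        by (simp add: e_def right_diff_distrib sum_subtractf sum_distrib_left mult.left_commute
            del: axis_nth)
      then show ?thesis by (simp only: pairing_axis) simp
    qed
    then have "pairing b (e i * e j) = 0" by (intro b)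
    moreover have "e i * e j = (a $ i * a $ j) *s axis k 1"
      using that by (auto simp: e_def axis_def vec_eq_iff)
    ultimately show ?thesis
      by (simp add: axis_def if_distrib cong: if_cong)
  qed
  have "b $ 1 = 0" "b $ 2 = 0" "b $ 3 = 0"
    using sep[of 2 1 3] sep[of 1 2 3] sep[of 1 3 2] a by auto
  then show ?thesis by (simp add: vec_eq_iff forall_3)
qed

lemma obtain_two_points:
  assumes "infinite X \<or> card X \<ge> 2"
  obtains v1 v2 where "v1 \<noteq> 0" "v2 \<noteq> 0" "Pt v1 \<in> X" "Pt v2 \<in> X" "Pt v1 \<noteq> Pt v2"
proof -
  have "\<not> (\<exists>P. X \<subseteq> {P})"
    using assms by (metis card_mono card.empty card_insert_le finite.emptyI finite.insertI
        finite_subset card_1_singleton_iff not_less_eq_eq numeral_2_eq_2 le_trans)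
  then obtain P Q where "P \<in> X" "Q \<in> X" "P \<noteq> Q" by blast
  with that show thesis by (metis proj2_cases)
qed

lemma hadamard_not_collinear:
  fixes X Y :: "'a::field proj2 set"
  assumes "infinite X \<or> card X \<ge> 2" "infinite Y \<or> card Y \<ge> 2"
    and XY: "X \<union> Y \<subseteq> {P. on_line a P}" and a: "\<And>k. a $ k \<noteq> 0"
  shows "\<not> collinear_points (X \<star> Y)"
proof
  assume "collinear_points (X \<star> Y)"
  then obtain b where "b \<noteq> 0" and
    b: "\<And>v w. v \<noteq> 0 \<Longrightarrow> w \<noteq> 0 \<Longrightarrow> Pt v \<in> X \<Longrightarrow> Pt w \<in> Y \<Longrightarrow> pairing b (v * w) = 0"
    unfolding collinear_hadamard_iff by blast
  obtain v1 v2 where v: "v1 \<noteq> 0" "v2 \<noteq> 0" "Pt v1 \<in> X" "Pt v2 \<in> X" "Pt v1 \<noteq> Pt v2"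
    using obtain_two_points assms(1) by blast
  obtain w1 w2 where w: "w1 \<noteq> 0" "w2 \<noteq> 0" "Pt w1 \<in> Y" "Pt w2 \<in> Y" "Pt w1 \<noteq> Pt w2"
    using obtain_two_points assms(2) by blast
  have va: "pairing a v1 = 0" "pairing a v2 = 0" and wa: "pairing a w1 = 0" "pairing a w2 = 0"
    using XY v w by (auto simp flip: on_line_Pt)
  have "pairing b (x * y) = 0" if x: "pairing a x = 0" and y: "pairing a y = 0" for x y
  proof -
    obtain r s where x: "x = r *s v1 + s *s v2"
      using line_spanned_by_two_points[OF a va x v(1,2,5)] .
    obtain p q where y: "y = p *s w1 + q *s w2"
      using line_spanned_by_two_points[OF a wa y w(1,2,5)] .
    show ?thesis
      unfolding x y pairing_combination using b v w by simp
  qed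
  then have "b = 0" using products_of_line_span a by blast
  with \<open>b \<noteq> 0\<close> show False by contradiction
qed

section \<open>Lines through a coordinate point\<close>

lemma other_two_indices:
  fixes k :: 3
  obtains i j where "UNIV = {i, j, k}" "i \<noteq> j" "i \<noteq> k" "j \<noteq> k"
proof -
  have U: "UNIV = {2, 3, 1 :: 3}" "UNIV = {1, 3, 2 :: 3}" "UNIV = {1, 2, 3 :: 3}"
    unfolding UNIV_3 by blast+
  have N: "2 \<noteq> (3::3)" "1 \<noteq> (2::3)" "1 \<noteq> (3::3)" by simp_all
  note N = N N[symmetric]
  from exhaust_3[of k] show thesis
  proof (elim disjE)
    assume k: "k = 1" show thesis by (rule that[of 2 3], unfold k) (rule U N)+
  next
    assume k: "k = 2" show thesis by (rule that[of 1 3], unfold k) (rule U N)+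
  next
    assume k: "k = 3" show thesis by (rule that[of 1 2], unfold k) (rule U N)+
  qed
qed

text \<open>
  The line through the products has the squares of the coefficients of the given line, one of
  them with its sign changed.
\<close>

lemma hadamard_collinear:
  fixes X Y :: "'a::field proj2 set"
  assumes XY: "X \<union> Y \<subseteq> {P. on_line a P}" and "a \<noteq> 0" and k: "a $ k = 0"
  shows "collinear_points (X \<star> Y)"
proof -
  obtain i j where UNIV: "UNIV = {i, j, k}" and ij: "i \<noteq> j" "i \<noteq> k" "j \<noteq> k"
    by (rule other_two_indices)
  have sum: "(\<Sum>l\<in>UNIV. f l) = f i + f j + f k" for f :: "3 \<Rightarrow> 'a"
    unfolding UNIV using ij by (simp add: add.assoc)
  let ?b = "(a $ i)^2 *s axis i 1 - (a $ j)^2 *s axis j 1"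
  have "a $ i \<noteq> 0 \<or> a $ j \<noteq> 0"
  proof (rule ccontr)
    assume zero: "\<not> (a $ i \<noteq> 0 \<or> a $ j \<noteq> 0)"
    have "a $ l = 0" for l
    proof -
      have "l \<in> {i, j, k}"
        unfolding UNIV[symmetric] by (rule UNIV_I)
      then show ?thesis using zero k by auto
    qed
    with \<open>a \<noteq> 0\<close> show False by (simp add: vec_eq_iff)
  qed
  then have "?b $ i \<noteq> 0 \<or> ?b $ j \<noteq> 0" using ij by (auto simp: axis_def)
  then have "?b \<noteq> 0" by (metis zero_index)
  moreover have "pairing ?b (v * w) = 0"
    if "v \<noteq> 0" "w \<noteq> 0" "Pt v \<in> X" "Pt w \<in> Y" for v w
  proof -
    have "pairing a v = 0" "pairing a w = 0"
      using XY that by (auto simp flip: on_line_Pt)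
    then have *: "a $ i * v $ i = - (a $ j * v $ j)" "a $ i * w $ i = - (a $ j * w $ j)"
      using k by (simp_all add: sum eq_neg_iff_add_eq_0)
    have "(a $ i * v $ i) * (a $ i * w $ i) = (a $ j * v $ j) * (a $ j * w $ j)"
      unfolding * by simp
    then show ?thesis
      using ij by (simp add: sum axis_def power2_eq_square algebra_simps)
  qed
  ultimately show ?thesis
    unfolding collinear_hadamard_iff by blast
qed

theorem theorem3p3:
  fixes X Y L :: "'a::alg_closed_field proj2 set"
  assumes "infinite X \<or> card X \<ge> 3"
    and "infinite Y \<or> card Y \<ge> 3"
    and "infinite (X \<union> Y) \<or> card (X \<union> Y) \<ge> 4"
    and "proj_line L"
    and "X \<union> Y \<subseteq> L"
  shows "\<not> collinear_points (X \<star> Y) \<longleftrightarrow> L \<inter> \<Delta>\<^sub>0 = {}"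
proof -
  obtain a where a: "a \<noteq> 0" "L = {P. on_line a P}"
    using assms(4) unfolding proj_line_def by blast
  have two: "infinite X \<or> card X \<ge> 2" "infinite Y \<or> card Y \<ge> 2"
    using assms(1,2) by auto
  have XY: "X \<union> Y \<subseteq> {P. on_line a P}" using assms(5) a(2) by blast
  show ?thesis
    unfolding line_meets_coord_points_iff[OF a(2)]
    using hadamard_not_collinear[OF two XY] hadamard_collinear[OF XY a(1)] by blast
qed

end
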